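(* Let $E$ be a subset of a normed linear space $X$ and let $A,B,S,T:E\to E$ be four selfmaps such that $u\in F(A)\cap F(B)\cap F(S)\cap F(T)$ for some $u\in X$, with $S(\partial E)\subset E$ and $T(\partial E)\subset E$. Assume that $P_E(u)$ is $q$-starshaped and compact with $q\in F(S)\cap F(T)$, that $S$ and $T$ are affine on $P_E(u)$, and that $S(P_E(u))=P_E(u)=T(P_E(u))$. Suppose also that for all $x,y\in P_E(u)\cup\{u\}$, $$\|Ax-By\|^{2}\le\begin{cases}\|Sx-Tu\|^{2} & \text{if } y=u,\\ \|Su-Ty\|^{2} & \text{if } x=u,\\ M(x,y) & \text{if } x,y\in P_E(u),\end{cases}$$ where $$\begin{aligned}M(x,y)={}& c_{1}\max\{[\delta(Sx,[q,Ax])]^{2},\,[\delta(Ty,[q,By])]^{2},\,\|Sx-Ty\|^{2}\}\\ &+c_{2}\max\{\delta(Sx,[q,Ax])\,\delta(Sx,[q,By]),\ \delta(Ty,[q,By])\,\delta(Ty,[q,Ax])\}\\ &+c_{3}\,\delta(Sx,[q,By])\,\delta(Ty,[q,Ax])\end{aligned}$$ and $c_1,c_2,c_3\ge 0$ are constants with $c_1+2c_2=1$ and $c_1+c_3=1$. Suppose that either the pairs $(A,S)$ and $(B,T)$, or the pairs $(A,T)$ and $(B,S)$, are reciprocally continuous on $P_E(u)$. If both the pairs $(A,S)$ and $(B,T)$ are $C_q$-commuting on $P_E(u)$, then $$P_E(u)\cap F(A)\cap F(B)\cap F(S)\cap F(T)\neq\emptyset.$$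
   Context: For a selfmap $f$, $F(f)$ denotes its set of fixed points. $\partial E$ is the boundary of $E$ in $X$. For $x\in X$ and nonempty $C\subseteq X$, $\delta(x,C)=\inf\{\|x-z\|:z\in C\}$. For $q,x\in X$, $[q,x]=\{\lambda x+(1-\lambda)q:0\le\lambda\le 1\}$ is the line segment joining $q$ to $x$. $P_E(u)=\{x\in E:\|x-u\|=\delta(u,E)\}$ is the set of best approximants to $u$ out of $E$. A set $D\subseteq X$ is $q$-starshaped if $q\in D$ and $\lambda x+(1-\lambda)q\in D$ for all $x\in D$ and $0<\lambda<1$. A map $f$ is affine on $D$ if $f(\lambda x+(1-\lambda)y)=\lambda f(x)+(1-\lambda)f(y)$ for all $x,y\in D$ and $\lambda\in(0,1)$. A pair $(f,g)$ is reciprocally continuous on $D$ if $\lim_n fgx_n=ft$ and $\lim_n gfx_n=gt$ whenever $\{x_n\}$ is a sequence in $D$ with $\lim_n fx_n=\lim_n gx_n=t$ for some $t\in D$. For $D$ $q$-starshaped, a pair $(f,g)$ is $C_q$-commuting on $D$ if $fgx=gfx$ for all $x\in \bigcup_{k\in[0,1]}\{x\in D: fx=kgx+(1-k)q\}$.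
   Formalization: For u outside E the claim fails as stated; there the C_q-commuting hypothesis is taken for the pairs (S,A) and (T,B) instead, i.e. commutation where Sx=kAx+(1-k)q, respectively Tx=kBx+(1-k)q. For u in E the hypothesis is as stated. *)

theory Defs
  imports "HOL-Analysis.Analysis"
begin

text \<open>
  Self-maps of a set \<open>E\<close> are rendered as total functions on the ambient space that map \<open>E\<close>
  into \<open>E\<close>, so that \<open>f u = u\<close> also makes sense for a point \<open>u\<close> outside \<open>E\<close>.
  The distance \<open>\<delta>(x, C)\<close> is \<^const>\<open>infdist\<close>; \<open>[q, x]\<close> is \<^const>\<open>closed_segment\<close>.
\<close>

definition fixed_pts :: "('a \<Rightarrow> 'a) \<Rightarrow> 'a set" where
  "fixed_pts f = {x. f x = x}"

definition best_approx :: "'a::real_normed_vector set \<Rightarrow> 'a \<Rightarrow> 'a set" where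
  "best_approx E u = {x \<in> E. norm (x - u) = infdist u E}"

definition starshaped :: "'a::real_normed_vector \<Rightarrow> 'a set \<Rightarrow> bool" where
  "starshaped q D \<longleftrightarrow>
     q \<in> D \<and> (\<forall>x\<in>D. \<forall>l::real. 0 < l \<and> l < 1 \<longrightarrow> l *\<^sub>R x + (1 - l) *\<^sub>R q \<in> D)"

text \<open>The set \<open>D\<close> need not be convex; the equation is required for all convex combinations.\<close>

definition affine_map_on :: "'a::real_normed_vector set \<Rightarrow> ('a \<Rightarrow> 'a) \<Rightarrow> bool" where
  "affine_map_on D f \<longleftrightarrow>
     (\<forall>x\<in>D. \<forall>y\<in>D. \<forall>l::real. 0 < l \<and> l < 1 \<longrightarrow>
        f (l *\<^sub>R x + (1 - l) *\<^sub>R y) = l *\<^sub>R f x + (1 - l) *\<^sub>R f y)"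

definition reciprocally_continuous ::
    "'a::real_normed_vector set \<Rightarrow> ('a \<Rightarrow> 'a) \<Rightarrow> ('a \<Rightarrow> 'a) \<Rightarrow> bool" where
  "reciprocally_continuous D f g \<longleftrightarrow>
     (\<forall>(x :: nat \<Rightarrow> 'a) t.
        (\<forall>n. x n \<in> D) \<and> t \<in> D \<and>
        (\<lambda>n. f (x n)) \<longlonglongrightarrow> t \<and> (\<lambda>n. g (x n)) \<longlonglongrightarrow> t \<longrightarrow>
        (\<lambda>n. f (g (x n))) \<longlonglongrightarrow> f t \<and> (\<lambda>n. g (f (x n))) \<longlonglongrightarrow> g t)"

text \<open>The notion is not symmetric: the order of \<open>f\<close> and \<open>g\<close> matters.\<close>

definition Cq_commuting ::
    "'a::real_normed_vector \<Rightarrow> 'a set \<Rightarrow> ('a \<Rightarrow> 'a) \<Rightarrow> ('a \<Rightarrow> 'a) \<Rightarrow> bool" where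
  "Cq_commuting q D f g \<longleftrightarrow>
     (\<forall>x \<in> (\<Union>k\<in>{0..1::real}. {x \<in> D. f x = k *\<^sub>R g x + (1 - k) *\<^sub>R q}).
        f (g x) = g (f x))"

definition M_bound ::
    "real \<Rightarrow> real \<Rightarrow> real \<Rightarrow> 'a::real_normed_vector \<Rightarrow>
     ('a \<Rightarrow> 'a) \<Rightarrow> ('a \<Rightarrow> 'a) \<Rightarrow> ('a \<Rightarrow> 'a) \<Rightarrow> ('a \<Rightarrow> 'a) \<Rightarrow> 'a \<Rightarrow> 'a \<Rightarrow> real" where
  "M_bound c1 c2 c3 q A B S T x y =
     c1 * Max {(infdist (S x) (closed_segment q (A x)))^2,
               (infdist (T y) (closed_segment q (B y)))^2,
               (norm (S x - T y))^2}
   + c2 * max (infdist (S x) (closed_segment q (A x)) * infdist (S x) (closed_segment q (B y)))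
              (infdist (T y) (closed_segment q (B y)) * infdist (T y) (closed_segment q (A x)))
   + c3 * (infdist (S x) (closed_segment q (B y)) * infdist (T y) (closed_segment q (A x)))"

text \<open>
  On the two commutation hypotheses of the theorem. For maps defined on \<open>E\<close> only, a common fixed
  point \<open>u\<close> lies in \<open>E\<close>, and the pairs \<open>(A, S)\<close>, \<open>(B, T)\<close> are taken literally in this order.
  Then \<open>best_approx E u = {u}\<close>. For \<open>u\<close> outside \<open>E\<close> that order makes the claim false: in the plane
  with the maximum norm take \<open>E = [-1,1] \<times> {0}\<close>, identified with \<open>[-1,1]\<close>, and \<open>u = (0,1)\<close>,
  \<open>q = 0\<close>, \<open>c1 = 1\<close>, \<open>c2 = c3 = 0\<close>; all maps fix \<open>u\<close>, \<open>S x = T x = - x\<close> on \<open>E\<close>, and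
  \<open>A = B\<close> sends \<open>x\<close> to \<open>-(1 + x)\<close> on \<open>[-1,0]\<close>, to \<open>-1\<close> on \<open>(0,1)\<close> and \<open>1\<close> to \<open>0\<close>.
  The result in that case uses the order \<open>(S, A)\<close>, \<open>(T, B)\<close>, that is commutation where
  \<open>S x = k *\<^sub>R A x + (1 - k) *\<^sub>R q\<close>, respectively \<open>T x = k *\<^sub>R B x + (1 - k) *\<^sub>R q\<close>.
\<close>

end

theory Submission
  imports Defs
begin

text \<open>
  If \<open>u \<in> E\<close> then \<open>u\<close> is its own only best approximant. Otherwise all four maps preserve the set
  \<open>D\<close> of best approximants, and for \<open>0 < k < 1\<close> the contractions \<open>k A + (1 - k) q\<close> and
  \<open>k B + (1 - k) q\<close> of \<open>A\<close> and \<open>B\<close> towards \<open>q\<close> satisfy the hypothesis with the extra factor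
  \<open>k\<^sup>2\<close>, since the distance to a segment is at most the distance to any of its points. A
  Jungck iteration gives a common fixed point \<open>z\<^sub>k\<close> of these two maps, \<open>S\<close> and \<open>T\<close>.
  By compactness some sequence of them with \<open>k \<rightarrow> 1\<close> converges; since
  \<open>A z\<^sub>k = B z\<^sub>k\<close>, either version of reciprocal continuity shows that the limit
  is fixed by all four maps.
\<close>

text \<open>
  With \<open>s, a, t, b\<close> in the roles of \<open>S x, A x, T y, B y\<close>, this is \<open>M(x, y)\<close> with the distances to
  segments replaced by distances to the points \<open>a\<close> and \<open>b\<close>.
\<close>

definition pair_bound ::
    "real \<Rightarrow> real \<Rightarrow> real \<Rightarrow> 'a::metric_space \<Rightarrow> 'a \<Rightarrow> 'a \<Rightarrow> 'a \<Rightarrow> real" where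
  "pair_bound c1 c2 c3 s a t b =
     c1 * max ((dist s a)\<^sup>2) (max ((dist t b)\<^sup>2) ((dist s t)\<^sup>2))
   + c2 * max (dist s a * dist s b) (dist t b * dist t a)
   + c3 * (dist s b * dist t a)"

section \<open>Inequalities for \<open>pair_bound\<close> at special configurations of
  points\<close>

lemma pair_bound_commute: "pair_bound c1 c2 c3 s a t b = pair_bound c1 c2 c3 t b s a"
  by (simp add: pair_bound_def dist_commute max.left_commute max.commute mult.commute)

text \<open>With \<open>m\<close> the larger of the two distances, the triangle inequality gives
  \<open>dist s b \<le> 2 * m\<close>; the \<open>c3\<close> term vanishes because the third point
  is \<open>a\<close>. Hence the bound is at most
  \<open>(c1 + 2 * c2) * m\<^sup>2 = m\<^sup>2\<close>. If \<open>m = dist a b\<close>, then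
  \<open>k < 1\<close> forces \<open>a = b\<close>.\<close>

lemma pair_bound_step:
  fixes a b s :: "'a::metric_space"
  assumes c: "c1 \<ge> 0" "c2 \<ge> 0" "c1 + 2 * c2 = 1" and k: "0 \<le> k" "k < 1"
    and le: "(dist a b)\<^sup>2 \<le> k\<^sup>2 * pair_bound c1 c2 c3 s a a b"
  shows "dist a b \<le> k * dist s a"
proof -
  define m where "m = max (dist s a) (dist a b)"
  have m: "0 \<le> m" "dist s a \<le> m" "dist a b \<le> m" "m = dist s a \<or> m = dist a b"
    by (auto simp: m_def max_def)
  have "dist s b \<le> 2 * m"
    using dist_triangle[of s b a] m by linarith
  then have "dist s a * dist s b \<le> m * (2 * m)"
    by (intro mult_mono) (use m in auto)
  then have 2: "max (dist s a * dist s b) (dist a b * dist a a) \<le> 2 * m\<^sup>2"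
    by (simp add: power2_eq_square)
  have 1: "max ((dist s a)\<^sup>2) (max ((dist a b)\<^sup>2) ((dist s a)\<^sup>2)) \<le> m\<^sup>2"
    using m by (simp add: power_mono)
  have "pair_bound c1 c2 c3 s a a b \<le> c1 * m\<^sup>2 + c2 * (2 * m\<^sup>2)"
    unfolding pair_bound_def
    using mult_left_mono[OF 1 c(1)] mult_left_mono[OF 2 c(2)] by simp
  also have "\<dots> = (c1 + 2 * c2) * m\<^sup>2"
    by (simp add: algebra_simps)
  finally have "pair_bound c1 c2 c3 s a a b \<le> m\<^sup>2"
    using c by simp
  then have "(dist a b)\<^sup>2 \<le> k\<^sup>2 * m\<^sup>2"
    using le by (meson mult_left_mono order_trans zero_le_power2)
  then have "(dist a b)\<^sup>2 \<le> (k * m)\<^sup>2"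
    by (simp add: power_mult_distrib)
  then have *: "dist a b \<le> k * m"
    using k m by (meson mult_nonneg_nonneg power2_le_imp_le)
  show ?thesis
  proof (cases "m = dist s a")
    case False
    then have "dist a b \<le> k * dist a b"
      using m * by auto
    then have "(1 - k) * dist a b \<le> 0"
      by (simp add: algebra_simps)
    then have "dist a b = 0"
      using k by (simp add: mult_le_0_iff)
    then show ?thesis
      using k by simp
  qed (use * in simp)
qed

text \<open>In the limit every product in the \<open>c2\<close> and \<open>c3\<close> terms has a
  zero factor, leaving \<open>c1 * (dist a z)\<^sup>2\<close>, and
  \<open>k\<^sup>2 * c1 < 1\<close>.\<close>

lemma pair_bound_tendsto_eq:
  fixes a z :: "'a::metric_space"
  assumes c: "c1 \<ge> 0" "c1 \<le> 1" and k: "0 \<le> k" "k < 1"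
    and lim: "b \<longlonglongrightarrow> z" "t \<longlonglongrightarrow> z"
    and le: "\<And>n::nat. (dist a (b n))\<^sup>2 \<le> k\<^sup>2 * pair_bound c1 c2 c3 z a (t n) (b n)"
  shows "a = z"
proof -
  have "(\<lambda>n. (dist a (b n))\<^sup>2) \<longlonglongrightarrow> (dist a z)\<^sup>2"
    by (intro tendsto_intros lim)
  moreover have "(\<lambda>n. k\<^sup>2 * pair_bound c1 c2 c3 z a (t n) (b n))
      \<longlonglongrightarrow> k\<^sup>2 * pair_bound c1 c2 c3 z a z z"
    unfolding pair_bound_def by (intro tendsto_intros tendsto_max lim)
  ultimately have "(dist a z)\<^sup>2 \<le> k\<^sup>2 * pair_bound c1 c2 c3 z a z z"
    using le by (intro LIMSEQ_le) auto
  also have "pair_bound c1 c2 c3 z a z z = c1 * (dist a z)\<^sup>2"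
    by (simp add: pair_bound_def dist_commute)
  finally have "(1 - k\<^sup>2 * c1) * (dist a z)\<^sup>2 \<le> 0"
    by (simp add: algebra_simps)
  moreover have "k\<^sup>2 < 1"
    using k by (simp add: power_less_one_iff)
  then have "k\<^sup>2 * c1 < 1"
    using c mult_left_le[of c1 "k\<^sup>2"] by simp
  ultimately show ?thesis
    by (simp add: mult_le_0_iff)
qed

text \<open>For coincidence points (\<open>s = a\<close>, \<open>t = b\<close>) only the
  \<open>c1\<close> and \<open>c3\<close> terms survive, with total coefficient
  \<open>c1 + c3 = 1\<close>.\<close>

lemma pair_bound_diagonal_eq:
  fixes a b :: "'a::metric_space"
  assumes c: "c1 + c3 = 1" and k: "0 \<le> k" "k < 1"
    and le: "(dist a b)\<^sup>2 \<le> k\<^sup>2 * pair_bound c1 c2 c3 a a b b"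
  shows "a = b"
proof -
  have "pair_bound c1 c2 c3 a a b b = (c1 + c3) * (dist a b)\<^sup>2"
    by (simp add: pair_bound_def dist_commute power2_eq_square algebra_simps)
  with le c have "(1 - k\<^sup>2) * (dist a b)\<^sup>2 \<le> 0"
    by (simp add: algebra_simps)
  moreover have "k\<^sup>2 < 1"
    using k by (simp add: power_less_one_iff)
  ultimately show ?thesis
    by (simp add: mult_le_0_iff)
qed

section \<open>Jungck iteration for four maps\<close>

lemma Cauchy_geometric:
  fixes y :: "nat \<Rightarrow> 'a::metric_space"
  assumes k: "0 \<le> k" "k < 1"
    and le: "\<And>n. dist (y (Suc n)) (y (Suc (Suc n))) \<le> k * dist (y n) (y (Suc n))"
  shows "Cauchy y"
proof -
  define d where "d = dist (y 0) (y 1)"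
  have step: "dist (y n) (y (Suc n)) \<le> k ^ n * d" for n
  proof (induction n)
    case (Suc n)
    then show ?case
      using le[of n] mult_left_mono[OF Suc k(1)] by (simp add: mult.assoc)
  qed (simp add: d_def)
  \<comment> \<open>Partial geometric sum, multiplied by \<open>1 - k\<close> so that the induction
    stays polynomial.\<close>
  have tail: "(1 - k) * dist (y n) (y (n + p)) \<le> (k ^ n - k ^ (n + p)) * d" for n p
  proof (induction p)
    case (Suc p)
    have "dist (y n) (y (n + Suc p))
        \<le> dist (y n) (y (n + p)) + dist (y (n + p)) (y (Suc (n + p)))"
      using dist_triangle by simp
    also have "\<dots> \<le> dist (y n) (y (n + p)) + k ^ (n + p) * d"
      using step by simp
    finally have "(1 - k) * dist (y n) (y (n + Suc p))
        \<le> (1 - k) * (dist (y n) (y (n + p)) + k ^ (n + p) * d)"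
      using k by (intro mult_left_mono) auto
    with Suc show ?case
      by (simp add: algebra_simps)
  qed simp
  have bound: "dist (y n) (y (n + p)) \<le> k ^ n * (d / (1 - k))" for n p
  proof -
    have "(k ^ n - k ^ (n + p)) * d \<le> k ^ n * d"
      using k by (intro mult_right_mono) (auto simp: d_def)
    with tail[of n p] have "(1 - k) * dist (y n) (y (n + p)) \<le> k ^ n * d"
      by linarith
    then show ?thesis
      using k by (simp add: field_simps)
  qed
  have "(\<lambda>n. k ^ n * (d / (1 - k))) \<longlonglongrightarrow> 0 * (d / (1 - k))"
    using k by (intro tendsto_intros LIMSEQ_power_zero) auto
  then have lim: "(\<lambda>n. k ^ n * (d / (1 - k))) \<longlonglongrightarrow> 0"
    by simp
  show ?thesis
    unfolding Cauchy_altdef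
  proof (intro allI impI)
    fix e :: real
    assume "e > 0"
    then obtain N where N: "\<And>n. n \<ge> N \<Longrightarrow> k ^ n * (d / (1 - k)) < e"
      using order_tendstoD(2)[OF lim] by (auto simp: eventually_sequentially)
    have "dist (y m) (y n) < e" if "m \<ge> N" "n > m" for m n
      using bound[of m "n - m"] N[of m] that by simp
    then show "\<exists>M. \<forall>m\<ge>M. \<forall>n>m. dist (y m) (y n) < e"
      by blast
  qed
qed

text \<open>The iterates converge to some \<open>z\<close> by completeness. Surjectivity provides
  preimages \<open>w\<close>, \<open>v\<close> of \<open>z\<close> under \<open>S\<close>,
  \<open>T\<close>; comparison with the iterates gives \<open>A w = z = B v\<close>, and commutation
  at these coincidence points carries the coincidence over to \<open>z\<close>.\<close>

lemma common_fixed_point_four_maps: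
  fixes A B S T :: "'a::metric_space \<Rightarrow> 'a"
  assumes D: "complete D" "D \<noteq> {}"
    and maps: "A ` D \<subseteq> D" "B ` D \<subseteq> D" and onto: "S ` D = D" "T ` D = D"
    and c: "c1 \<ge> 0" "c2 \<ge> 0" "c1 + 2 * c2 = 1" "c1 + c3 = 1"
    and k: "0 \<le> k" "k < 1"
    and le: "\<And>x y. x \<in> D \<Longrightarrow> y \<in> D \<Longrightarrow>
      (dist (A x) (B y))\<^sup>2 \<le> k\<^sup>2 * pair_bound c1 c2 c3 (S x) (A x) (T y) (B y)"
    and comm: "\<And>x. x \<in> D \<Longrightarrow> A x = S x \<Longrightarrow> A (S x) = S (A x)"
              "\<And>x. x \<in> D \<Longrightarrow> B x = T x \<Longrightarrow> B (T x) = T (B x)"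
  obtains z where "z \<in> D" "A z = z" "B z = z" "S z = z" "T z = z"
proof -
  \<comment> \<open>Exchanging the pairs \<open>(A, S)\<close> and \<open>(B, T)\<close> lets even
    and odd steps use the same lemmas.\<close>
  have le': "(dist (B y) (A x))\<^sup>2 \<le> k\<^sup>2 * pair_bound c1 c2 c3 (T y) (B y) (S x) (A x)"
    if "x \<in> D" "y \<in> D" for x y
    using le[OF that] by (simp add: dist_commute pair_bound_commute)
  obtain x0 where x0: "x0 \<in> D"
    using D by blast
  define s where "s = inv_into D S"
  define t where "t = inv_into D T"
  have s: "s w \<in> D" "S (s w) = w" if "w \<in> D" for w
    using that onto unfolding s_def by (auto intro: inv_into_into f_inv_into_f)
  have t: "t w \<in> D" "T (t w) = w" if "w \<in> D" for w
    using that onto unfolding t_def by (auto intro: inv_into_into f_inv_into_f)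
  \<comment> \<open>Preimages are chosen so that \<open>T (x (n + 1)) = A (x n)\<close> for even
    \<open>n\<close> and \<open>S (x (n + 1)) = B (x n)\<close> for odd \<open>n\<close>;
    \<open>y n\<close> is this common value.\<close>
  define x where "x = rec_nat x0 (\<lambda>n w. if even n then t (A w) else s (B w))"
  have x_0: "x 0 = x0" and x_Suc: "x (Suc n) = (if even n then t (A (x n)) else s (B (x n)))" for n
    by (simp_all add: x_def)
  have xD: "x n \<in> D" for n
    by (induction n) (use x0 s t maps in \<open>auto simp: x_0 x_Suc\<close>)
  define y where "y n = (if even n then A (x n) else B (x n))" for n
  have yD: "y n \<in> D" for n
    using xD maps by (auto simp: y_def)
  have Ty: "T (x (Suc n)) = y n" if "even n" for n
    using that t(2)[OF yD, of n] by (simp add: y_def x_Suc)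
  have Sy: "S (x (Suc n)) = y n" if "odd n" for n
    using that s(2)[OF yD, of n] by (simp add: y_def x_Suc)
  have "dist (y (Suc n)) (y (Suc (Suc n))) \<le> k * dist (y n) (y (Suc n))" for n
  proof (cases "even n")
    case True
    then have "(dist (y (Suc n)) (y (Suc (Suc n))))\<^sup>2
        \<le> k\<^sup>2 * pair_bound c1 c2 c3 (y n) (y (Suc n)) (y (Suc n)) (y (Suc (Suc n)))"
      using le'[OF xD xD, of "Suc n" "Suc (Suc n)"] Ty[of n] Sy[of "Suc n"] by (simp add: y_def)
    then show ?thesis
      by (rule pair_bound_step[OF c(1-3) k])
  next
    case False
    then have "(dist (y (Suc n)) (y (Suc (Suc n))))\<^sup>2
        \<le> k\<^sup>2 * pair_bound c1 c2 c3 (y n) (y (Suc n)) (y (Suc n)) (y (Suc (Suc n)))"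
      using le[OF xD xD, of "Suc n" "Suc (Suc n)"] Sy[of n] Ty[of "Suc n"] by (simp add: y_def)
    then show ?thesis
      by (rule pair_bound_step[OF c(1-3) k])
  qed
  then have "Cauchy y"
    by (rule Cauchy_geometric[OF k])
  then obtain z where z: "z \<in> D" "y \<longlonglongrightarrow> z"
    using D yD unfolding complete_def by blast
  have sub: "(\<lambda>n. y (2 * n + i)) \<longlonglongrightarrow> z" for i
    using LIMSEQ_subseq_LIMSEQ[OF z(2), of "\<lambda>n. 2 * n + i"]
    by (simp add: strict_mono_def o_def)
  have c1: "c1 \<le> 1"
    using c by linarith
  define w where "w = s z"
  define v where "v = t z"
  have w: "w \<in> D" "S w = z" and v: "v \<in> D" "T v = z"
    using s t z by (auto simp: w_def v_def)
  \<comment> \<open>\<open>w\<close> is compared with \<open>x (2 * n + 1)\<close>, whose images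
    under \<open>T\<close> and \<open>B\<close> are the consecutive terms \<open>y (2 * n)\<close>
    and \<open>y (2 * n + 1)\<close>.\<close>
  have Aw: "A w = z"
  proof (rule pair_bound_tendsto_eq[OF c(1) c1 k sub[of 1] sub[of 0]])
    show "(dist (A w) (y (2 * n + 1)))\<^sup>2
        \<le> k\<^sup>2 * pair_bound c1 c2 c3 z (A w) (y (2 * n + 0)) (y (2 * n + 1))" for n
      using le[OF w(1) xD, of "2 * n + 1"] Ty[of "2 * n"] w by (simp add: y_def)
  qed
  have Bv: "B v = z"
  proof (rule pair_bound_tendsto_eq[OF c(1) c1 k sub[of 2] sub[of 1]])
    show "(dist (B v) (y (2 * n + 2)))\<^sup>2
        \<le> k\<^sup>2 * pair_bound c1 c2 c3 z (B v) (y (2 * n + 1)) (y (2 * n + 2))" for n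
      using le'[OF xD v(1), of "2 * n + 2"] Sy[of "2 * n + 1"] v by (simp add: y_def)
  qed
  have Az: "A z = S z"
    using comm(1)[of w] w Aw by simp
  have Bz: "B z = T z"
    using comm(2)[of v] v Bv by simp
  \<comment> \<open>Comparing \<open>z\<close> with \<open>v\<close>, where
    \<open>B v = T v = z\<close>, is a diagonal case since \<open>A z = S z\<close>.\<close>
  have Azz: "A z = z"
    using le[OF z(1) v(1)] v Bv
    by (intro pair_bound_diagonal_eq[OF c(4) k]) (simp add: Az)
  have "A z = B z"
    using le[OF z(1) z(1)]
    by (intro pair_bound_diagonal_eq[OF c(4) k]) (simp add: Az Bz)
  with Azz Az Bz z that show thesis
    by simp
qed

text \<open>Each term of \<open>M_bound\<close> is monotone in nonnegative distances. It is applied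
  to the images of \<open>x\<close> and \<open>y\<close> under the contractions of \<open>A\<close>
  and \<open>B\<close> towards \<open>q\<close>, which lie on the segments.\<close>

lemma M_bound_le_pair_bound:
  assumes c: "c1 \<ge> 0" "c2 \<ge> 0" "c3 \<ge> 0"
    and a: "a \<in> closed_segment q (A x)" and b: "b \<in> closed_segment q (B y)"
  shows "M_bound c1 c2 c3 q A B S T x y \<le> pair_bound c1 c2 c3 (S x) a (T y) b"
proof -
  note [simp] = infdist_nonneg infdist_le[OF a] infdist_le[OF b]
  have "Max {(infdist (S x) (closed_segment q (A x)))\<^sup>2,
               (infdist (T y) (closed_segment q (B y)))\<^sup>2, (norm (S x - T y))\<^sup>2}
    \<le> max ((dist (S x) a)\<^sup>2) (max ((dist (T y) b)\<^sup>2) ((dist (S x) (T y))\<^sup>2))"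
    unfolding dist_norm[symmetric]
    by (simp del: max.bounded_iff) (intro max.mono power_mono order_refl; simp)
  then show ?thesis
    unfolding M_bound_def pair_bound_def
    by (intro add_mono mult_left_mono max.mono mult_mono c) auto
qed

lemma best_approx_self:
  assumes "u \<in> E"
  shows "best_approx E u = {u}"
  using assms by (auto simp: best_approx_def)

lemma Cq_commutingD:
  assumes "Cq_commuting q D f g" "x \<in> D" "0 \<le> k" "k \<le> 1" "f x = k *\<^sub>R g x + (1 - k) *\<^sub>R q"
  shows "f (g x) = g (f x)"
proof -
  have "x \<in> (\<Union>k\<in>{0..1::real}. {x \<in> D. f x = k *\<^sub>R g x + (1 - k) *\<^sub>R q})"
    using assms(2-5) by (intro UN_I[of k]) auto
  then show ?thesis
    using assms(1) unfolding Cq_commuting_def by blast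
qed

theorem theorem3p2:
  fixes E :: "'a::real_normed_vector set"
    and A B S T :: "'a \<Rightarrow> 'a"
    and u q :: 'a
    and c1 c2 c3 :: real
  assumes selfmaps: "A ` E \<subseteq> E" "B ` E \<subseteq> E" "S ` E \<subseteq> E" "T ` E \<subseteq> E"
    and u_fix: "u \<in> fixed_pts A \<inter> fixed_pts B \<inter> fixed_pts S \<inter> fixed_pts T"
    and bdry: "S ` frontier E \<subseteq> E" "T ` frontier E \<subseteq> E"
    and star: "starshaped q (best_approx E u)"
    and comp: "compact (best_approx E u)"
    and q_fix: "q \<in> fixed_pts S \<inter> fixed_pts T"
    and aff: "affine_map_on (best_approx E u) S" "affine_map_on (best_approx E u) T"
    and onto: "S ` best_approx E u = best_approx E u" "T ` best_approx E u = best_approx E u"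
    and coeffs: "c1 \<ge> 0" "c2 \<ge> 0" "c3 \<ge> 0" "c1 + 2 * c2 = 1" "c1 + c3 = 1"
    and contr: "\<forall>x \<in> best_approx E u \<union> {u}. \<forall>y \<in> best_approx E u \<union> {u}.
        (norm (A x - B y))^2 \<le>
          (if y = u then (norm (S x - T u))^2
           else if x = u then (norm (S u - T y))^2
           else M_bound c1 c2 c3 q A B S T x y)"
    and rc: "(reciprocally_continuous (best_approx E u) A S \<and>
              reciprocally_continuous (best_approx E u) B T) \<or>
             (reciprocally_continuous (best_approx E u) A T \<and>
              reciprocally_continuous (best_approx E u) B S)"
    and Cq_inside: "u \<in> E \<Longrightarrow> Cq_commuting q (best_approx E u) A S \<and>
                             Cq_commuting q (best_approx E u) B T"
    and Cq_outside: "u \<notin> E \<Longrightarrow> Cq_commuting q (best_approx E u) S A \<and>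
                                 Cq_commuting q (best_approx E u) T B"
  shows "best_approx E u \<inter> fixed_pts A \<inter> fixed_pts B \<inter> fixed_pts S \<inter> fixed_pts T \<noteq> {}"
proof (cases "u \<in> E")
  case True
  then show ?thesis
    using u_fix by (auto simp: best_approx_self)
next
  case False

  \<comment> \<open>Invariance of the set of best approximants\<close>
  define D where "D = best_approx E u"
  have uD: "u \<notin> D"
    using False by (auto simp: D_def best_approx_def)
  have u: "A u = u" "B u = u" "S u = u" "T u = u" and q: "S q = q" "T q = q"
    using u_fix q_fix by (auto simp: fixed_pts_def)
  have onto': "S ` D = D" "T ` D = D"
    using onto by (simp_all add: D_def)
  have qD: "q \<in> D" and starD: "\<And>x l. x \<in> D \<Longrightarrow> 0 < l \<Longrightarrow> l < 1 \<Longrightarrow> l *\<^sub>R x + (1 - l) *\<^sub>R q \<in> D"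
    using star by (auto simp: starshaped_def D_def)
  have memD: "w \<in> D" if "w \<in> E" "norm (w - u) \<le> norm (x - u)" "x \<in> D" for w x
    using that infdist_le[of w E u]
    by (auto simp: D_def best_approx_def dist_norm norm_minus_commute)
  \<comment> \<open>Taking \<open>y = u\<close> bounds the distance from \<open>A x\<close> to
    \<open>u\<close> by that from \<open>S x\<close>, and \<open>S x\<close> is a best
    approximant.\<close>
  have AD: "A ` D \<subseteq> D"
  proof (intro image_subsetI)
    fix x assume x: "x \<in> D"
    then have "(norm (A x - u))\<^sup>2 \<le> (norm (S x - u))\<^sup>2"
      using contr[rule_format, of x u] u by (simp add: D_def)
    then have "norm (A x - u) \<le> norm (S x - u)"
      by (simp add: power_mono_iff)
    then show "A x \<in> D"
      by (rule memD[rotated]) (use x selfmaps onto' in \<open>auto simp: D_def best_approx_def\<close>)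
  qed
  \<comment> \<open>Taking \<open>x = u\<close>; the second case of the hypothesis applies because
    \<open>u\<close> lies outside \<open>D\<close>.\<close>
  have BD: "B ` D \<subseteq> D"
  proof (intro image_subsetI)
    fix x assume x: "x \<in> D"
    then have "(norm (u - B x))\<^sup>2 \<le> (norm (u - T x))\<^sup>2"
      using contr[rule_format, of u x] u uD by (auto simp: D_def split: if_splits)
    then have "norm (B x - u) \<le> norm (T x - u)"
      by (simp add: power_mono_iff norm_minus_commute)
    then show "B x \<in> D"
      by (rule memD[rotated]) (use x selfmaps onto' in \<open>auto simp: D_def best_approx_def\<close>)
  qed
  have contrD: "(norm (A x - B y))\<^sup>2 \<le> M_bound c1 c2 c3 q A B S T x y" if "x \<in> D" "y \<in> D" for x y
  proof -
    have "x \<noteq> u" "y \<noteq> u"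
      using that uD by auto
    then show ?thesis
      using contr[rule_format, of x y] that by (simp add: D_def)
  qed
  \<comment> \<open>As \<open>q\<close> is fixed, affinity makes \<open>S\<close> and
    \<open>T\<close> commute with contraction towards \<open>q\<close>.\<close>
  have affD: "f (k *\<^sub>R x + (1 - k) *\<^sub>R q) = k *\<^sub>R f x + (1 - k) *\<^sub>R q"
    if "f = S \<or> f = T" "x \<in> D" "0 < k" "k < 1" for f x k
    using that aff q qD by (auto simp: affine_map_on_def D_def)
  have CA: "A (S x) = S (A x)" if "x \<in> D" "0 < k" "k < 1" "k *\<^sub>R A x + (1 - k) *\<^sub>R q = S x" for x k
    using Cq_commutingD[of q D S A x k] Cq_outside[OF False] that by (simp add: D_def)
  have CB: "B (T x) = T (B x)" if "x \<in> D" "0 < k" "k < 1" "k *\<^sub>R B x + (1 - k) *\<^sub>R q = T x" for x k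
    using Cq_commutingD[of q D T B x k] Cq_outside[OF False] that by (simp add: D_def)

  \<comment> \<open>Common fixed points of the contracted maps\<close>
  have ex: "\<exists>z\<in>D. S z = z \<and> T z = z \<and> k *\<^sub>R A z + (1 - k) *\<^sub>R q = z \<and>
      k *\<^sub>R B z + (1 - k) *\<^sub>R q = z" if k: "0 < k" "k < 1" for k
  proof -
    define A' where "A' x = k *\<^sub>R A x + (1 - k) *\<^sub>R q" for x
    define B' where "B' x = k *\<^sub>R B x + (1 - k) *\<^sub>R q" for x
    have D: "complete D" "D \<noteq> {}"
      using comp qD by (auto simp: D_def compact_imp_complete)
    have ABD: "A' ` D \<subseteq> D" "B' ` D \<subseteq> D"
      using AD BD starD k by (auto simp: A'_def B'_def)
    have le: "(dist (A' x) (B' y))\<^sup>2 \<le> k\<^sup>2 * pair_bound c1 c2 c3 (S x) (A' x) (T y) (B' y)"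
      if xy: "x \<in> D" "y \<in> D" for x y
    proof -
      have "A' x \<in> closed_segment q (A x)" "B' y \<in> closed_segment q (B y)"
        using k by (auto simp: A'_def B'_def closed_segment_def intro!: exI[of _ k])
      then have "M_bound c1 c2 c3 q A B S T x y \<le> pair_bound c1 c2 c3 (S x) (A' x) (T y) (B' y)"
        using coeffs by (intro M_bound_le_pair_bound) auto
      then have "(norm (A x - B y))\<^sup>2 \<le> pair_bound c1 c2 c3 (S x) (A' x) (T y) (B' y)"
        using contrD[OF xy] by linarith
      moreover have "A' x - B' y = k *\<^sub>R (A x - B y)"
        by (simp add: A'_def B'_def algebra_simps)
      then have "(dist (A' x) (B' y))\<^sup>2 = k\<^sup>2 * (norm (A x - B y))\<^sup>2"
        using k by (simp add: dist_norm power_mult_distrib)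
      ultimately show ?thesis
        by (simp add: mult_left_mono)
    qed
    \<comment> \<open>A coincidence point of \<open>A'\<close> and \<open>S\<close> is exactly a
      point where \<open>C_q\<close>-commutation with parameter \<open>k\<close> applies; affinity
      then passes from \<open>A\<close> to \<open>A'\<close>.\<close>
    have commA: "A' (S x) = S (A' x)" if "x \<in> D" "A' x = S x" for x
      using CA[of x k] affD[of S "A x" k] AD that k by (auto simp: A'_def)
    have commB: "B' (T x) = T (B' x)" if "x \<in> D" "B' x = T x" for x
      using CB[of x k] affD[of T "B x" k] BD that k by (auto simp: B'_def)
    obtain z where "z \<in> D" "A' z = z" "B' z = z" "S z = z" "T z = z"
      using common_fixed_point_four_maps[OF D ABD onto' coeffs(1,2,4,5) less_imp_le[OF k(1)] k(2) le commA commB] .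
    then show ?thesis
      unfolding A'_def B'_def by blast
  qed

  \<comment> \<open>Passage to the limit\<close>
  \<comment> \<open>The shift by 2 keeps \<open>k 0 = 1 / 2\<close> positive.\<close>
  define k where "k n = 1 - 1 / real (n + 2)" for n
  have k: "0 < k n" "k n < 1" for n
    by (auto simp: k_def field_simps)
  have k_lim: "k \<longlonglongrightarrow> 1"
    using tendsto_diff[OF tendsto_const LIMSEQ_ignore_initial_segment[OF lim_1_over_n, of 2], of "1::real"]
    by (simp add: k_def[abs_def])
  obtain z where z: "z n \<in> D" "S (z n) = z n" "T (z n) = z n"
      "k n *\<^sub>R A (z n) + (1 - k n) *\<^sub>R q = z n" "k n *\<^sub>R B (z n) + (1 - k n) *\<^sub>R q = z n" for n
    using ex[OF k] by metis
  obtain p r where p: "p \<in> D" "strict_mono (r :: nat \<Rightarrow> nat)" "(z \<circ> r) \<longlonglongrightarrow> p"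
    using comp z(1) unfolding compact_def D_def by metis
  define w where "w = z \<circ> r"
  have AB: "A (z n) = B (z n)" for n
  proof -
    have "k n *\<^sub>R A (z n) = k n *\<^sub>R B (z n)"
      using z(4,5)[of n] by (metis add_right_cancel)
    then show ?thesis
      using k[of n] by simp
  qed
  \<comment> \<open>Solving the fixed-point equation for \<open>A (z n)\<close> yields convergence
    of \<open>A (w n)\<close> without continuity of \<open>A\<close>.\<close>
  have A_eq: "A (z n) = inverse (k n) *\<^sub>R (z n - (1 - k n) *\<^sub>R q)" for n
  proof -
    have "z n - (1 - k n) *\<^sub>R q = k n *\<^sub>R A (z n)"
      using z(4)[of n] by (simp add: algebra_simps)
    then show ?thesis
      using k[of n] by simp
  qed
  have kr: "(k \<circ> r) \<longlonglongrightarrow> 1"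
    using LIMSEQ_subseq_LIMSEQ[OF k_lim p(2)] .
  have "(\<lambda>n. inverse ((k \<circ> r) n) *\<^sub>R (w n - (1 - (k \<circ> r) n) *\<^sub>R q))
      \<longlonglongrightarrow> inverse 1 *\<^sub>R (p - (1 - 1) *\<^sub>R q)"
    using p(3) by (intro tendsto_intros kr) (auto simp: w_def o_def)
  then have Aw: "(\<lambda>n. A (w n)) \<longlonglongrightarrow> p"
    by (simp add: w_def A_eq)
  have w: "w n \<in> D" "S (w n) = w n" "T (w n) = w n" "B (w n) = A (w n)" for n
    using z AB by (auto simp: w_def o_def)
  \<comment> \<open>The equation for \<open>z n\<close> is itself a \<open>C_q\<close>-coincidence.
    With \<open>A (z n) = B (z n)\<close>, the point \<open>A (w n)\<close> is fixed by both
    \<open>S\<close> and \<open>T\<close>, so the crossed pairs can be treated alike.\<close>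
  have SA: "S (A (w n)) = A (w n)" for n
    using CA[OF z(1) k, of "r n" "r n"] z by (simp add: w_def)
  have TA: "T (A (w n)) = A (w n)" for n
    using CB[OF z(1) k, of "r n" "r n"] z AB by (simp add: w_def)
  have w_lim: "w \<longlonglongrightarrow> p"
    using p by (simp add: w_def)
  \<comment> \<open>Both \<open>f (g (w n))\<close> and \<open>g (f (w n))\<close> equal
    \<open>A (w n)\<close>, which tends to \<open>p\<close>, so uniqueness of limits identifies
    \<open>f p\<close> and \<open>g p\<close> with \<open>p\<close>.\<close>
  have rcD: "f p = p \<and> g p = p"
    if "reciprocally_continuous D f g" "f = A \<or> f = B" "g = S \<or> g = T" for f g
  proof -
    have f: "f (w n) = A (w n)" and g: "g (w n) = w n" "g (A (w n)) = A (w n)" for n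
      using that(2,3) w SA TA by auto
    have "(\<lambda>n. f (g (w n))) \<longlonglongrightarrow> f p \<and> (\<lambda>n. g (f (w n))) \<longlonglongrightarrow> g p"
      using that(1)[unfolded reciprocally_continuous_def, rule_format, of w p] w(1) p(1) Aw w_lim
      by (simp add: f g)
    then show ?thesis
      unfolding f g using LIMSEQ_unique[OF Aw] by metis
  qed
  have "A p = p \<and> B p = p \<and> S p = p \<and> T p = p"
    using rc
  proof (elim disjE conjE)
    assume "reciprocally_continuous (best_approx E u) A S" "reciprocally_continuous (best_approx E u) B T"
    then show ?thesis
      using rcD[of A S] rcD[of B T] by (simp add: D_def)
  next
    assume "reciprocally_continuous (best_approx E u) A T" "reciprocally_continuous (best_approx E u) B S"
    then show ?thesis
      using rcD[of A T] rcD[of B S] by (simp add: D_def)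
  qed
  then show ?thesis
    using p(1) by (auto simp: D_def fixed_pts_def)
qed

end
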